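(* Let $G$ be a finite simple graph with no isolated vertices, with $n$ vertices, $m$ edges and vertex degrees $d_1,\dots,d_n$, and let $R_\alpha=\sum_{ij\in E(G)}(d_id_j)^\alpha$. Then for every $0<\alpha\le 1$, \[R_\alpha\le m(2m-n+1)^\alpha.\]
   Context: $R_\alpha$ is the general Randić index; the sum runs over all edges $ij$ of $G$, with $d_i$ the degree of vertex $i$. *)

theory Defs
  imports Complex_Main
begin

text \<open>Simple graphs are given by a vertex set and a set of edges, each edge being the
  two-element set of its end points. Hence loops and multiple edges are excluded and every
  edge \<open>ij\<close> is counted once in a sum over the edge set.\<close>

locale fin_simple_graph =
  fixes V :: "'a set" and E :: "'a set set"
  assumes finite_V: "finite V"
    and edges: "\<And>e. e \<in> E \<Longrightarrow> e \<subseteq> V \<and> card e = 2"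

definition degree :: "'a set set \<Rightarrow> 'a \<Rightarrow> nat" where
  "degree E v = card {e \<in> E. v \<in> e}"

definition isolated :: "'a set set \<Rightarrow> 'a \<Rightarrow> bool" where
  "isolated E v \<longleftrightarrow> (\<forall>e\<in>E. v \<notin> e)"

text \<open>For an edge \<open>e = {i, j}\<close> the inner product over the end points is the product of the
  two end-point degrees. Since end points of edges have positive degree, the base of
  \<open>powr\<close> is positive.\<close>

definition randic_index :: "real \<Rightarrow> 'a set set \<Rightarrow> real" where
  "randic_index \<alpha> E = (\<Sum>e\<in>E. (\<Prod>v\<in>e. real (degree E v)) powr \<alpha>)"

lemma prod_degree_edge:
  "i \<noteq> j \<Longrightarrow> (\<Prod>v\<in>{i, j}. real (degree E v)) = real (degree E i) * real (degree E j)"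
  by simp

end

theory Submission
  imports Defs "HOL-Analysis.Convex"
begin

text \<open>For a vertex \<open>v\<close> let \<open>S v\<close> be the sum of the degrees of its neighbours. As every vertex has
  degree at least one, \<open>S v - d v\<close> is at most the sum of \<open>d u - 1\<close> over all \<open>u \<noteq> v\<close>, so
  \<open>S v \<le> K\<close> with \<open>K = 2 m - n + 1\<close>. Hence \<open>2 R\<^sub>1\<close>, which is the sum of \<open>d v * S v\<close>, is
  at most \<open>2 m K\<close>. For general \<open>\<alpha>\<close> bound each summand \<open>x powr \<alpha>\<close> by the tangent
  \<open>K powr \<alpha> * (1 + \<alpha> * (x / K - 1))\<close> of the concave power function at \<open>K\<close>.\<close>

text \<open>Built from the singletons \<open>e - {v}\<close>, so that sums over neighbours become
  sums over incident edges.\<close>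

definition neighbours :: "'a set set \<Rightarrow> 'a \<Rightarrow> 'a set" where
  "neighbours E v = (\<Union>e\<in>{e \<in> E. v \<in> e}. e - {v})"

text \<open>Weighted AM-GM for \<open>x / k\<close> and 1 with weights \<open>a\<close> and
  \<open>1 - a\<close>, scaled by \<open>k powr a\<close>. The form of Young's inequality used wants
  positive bases, hence the case \<open>x = 0\<close>.\<close>

lemma powr_le_tangent:
  fixes x k a :: real
  assumes "0 \<le> x" "0 < k" "0 < a" "a \<le> 1"
  shows "x powr a \<le> k powr a * (1 + a * (x / k - 1))"
proof (cases "x = 0")
  case True
  then show ?thesis using assms by simp
next
  case False
  have "(x / k) powr a * 1 powr (1 - a) \<le> a * (x / k) + (1 - a) * 1"
    by (rule Youngs_inequality_0) (use assms False in auto)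
  then have "k powr a * (x / k) powr a \<le> k powr a * (1 + a * (x / k - 1))"
    by (intro mult_left_mono) (auto simp: algebra_simps)
  then show ?thesis
    using assms by (simp add: powr_divide)
qed

context fin_simple_graph
begin

lemma finite_E: "finite E"
  by (rule finite_subset[of _ "Pow V"]) (use edges finite_V in auto)

lemma finite_edge: "e \<in> E \<Longrightarrow> finite e"
  using edges finite_V finite_subset by blast

lemma card_edge_minus: "e \<in> E \<Longrightarrow> v \<in> e \<Longrightarrow> card (e - {v}) = 1"
  using edges[of e] by simp

text \<open>An edge through \<open>v\<close> is determined by its other end point.\<close>

lemma disjoint_edges_minus:
  assumes "e \<in> E" "f \<in> E" "v \<in> e" "v \<in> f" "e \<noteq> f"
  shows "(e - {v}) \<inter> (f - {v}) = {}"
proof -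
  obtain a b where "e - {v} = {a}" "f - {v} = {b}"
    using assms card_edge_minus card_1_singletonE by metis
  with assms show ?thesis by (metis Int_insert_right_if0 inf_bot_right insert_Diff singletonD)
qed

lemma sum_neighbours:
  "sum f (neighbours E v) = (\<Sum>e | e \<in> E \<and> v \<in> e. sum f (e - {v}))"
  unfolding neighbours_def
  by (rule sum.UNION_disjoint) (use finite_E finite_edge disjoint_edges_minus in auto)

lemma card_neighbours: "card (neighbours E v) = degree E v"
  using sum_neighbours[of "\<lambda>_. 1 :: nat" v]
  by (simp add: degree_def card_edge_minus del: card_Diff_singleton card_Diff_insert)

lemma neighbours_subset: "neighbours E v \<subseteq> V - {v}"
  using edges by (auto simp: neighbours_def)

text \<open>Double counting of incidences: constant \<open>g\<close> gives the handshake lemma, and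
  a \<open>g\<close> that depends only on \<open>e\<close> counts each edge twice.\<close>

lemma sum_incident:
  fixes g :: "'a \<Rightarrow> 'a set \<Rightarrow> real"
  shows "(\<Sum>v\<in>V. \<Sum>e | e \<in> E \<and> v \<in> e. g v e) = (\<Sum>e\<in>E. \<Sum>v\<in>e. g v e)"
proof -
  have "(\<Sum>v\<in>V. \<Sum>e | e \<in> E \<and> v \<in> e. g v e) = (\<Sum>e\<in>E. \<Sum>v | v \<in> V \<and> v \<in> e. g v e)"
    by (rule sum.swap_restrict) (auto simp: finite_V finite_E)
  also have "\<dots> = (\<Sum>e\<in>E. \<Sum>v\<in>e. g v e)"
    by (intro sum.cong refl) (use edges in blast)+
  finally show ?thesis .
qed

lemma sum_degree: "(\<Sum>v\<in>V. real (degree E v)) = 2 * real (card E)"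
  using sum_incident[of "\<lambda>_ _. 1"] edges by (simp add: degree_def)

lemma degree_ge_1: "v \<in> V \<Longrightarrow> \<not> isolated E v \<Longrightarrow> 1 \<le> degree E v"
  using finite_E by (auto simp: degree_def isolated_def Suc_le_eq card_gt_0_iff)

lemma sum_degree_neighbours_le:
  assumes "\<And>u. u \<in> V \<Longrightarrow> \<not> isolated E u" "v \<in> V"
  shows "(\<Sum>u\<in>neighbours E v. real (degree E u)) \<le> 2 * real (card E) - real (card V) + 1"
proof -
  \<comment> \<open>There are \<open>degree E v\<close> neighbours, so each summand loses 1. It
    stays nonnegative without isolated vertices, which allows the larger index set below.\<close>
  have "(\<Sum>u\<in>neighbours E v. real (degree E u)) - real (degree E v)
      = (\<Sum>u\<in>neighbours E v. real (degree E u) - 1)"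
    by (simp add: sum_subtractf card_neighbours)
  also have "\<dots> \<le> (\<Sum>u\<in>V - {v}. real (degree E u) - 1)"
    using neighbours_subset finite_V degree_ge_1 assms by (intro sum_mono2) force+
  \<comment> \<open>Leaving out \<open>v\<close> gives back \<open>- degree E v\<close>, which
    cancels against the left side, and the final \<open>+ 1\<close>.\<close>
  also have "\<dots> = (\<Sum>u\<in>V. real (degree E u) - 1) - (real (degree E v) - 1)"
    using assms finite_V by (simp add: sum_diff1)
  also have "\<dots> = 2 * real (card E) - real (card V) - real (degree E v) + 1"
    by (simp add: sum_subtractf sum_degree)
  finally show ?thesis by simp
qed

lemma sum_degree_product_le:
  assumes "\<And>u. u \<in> V \<Longrightarrow> \<not> isolated E u"
  shows "(\<Sum>e\<in>E. \<Prod>v\<in>e. real (degree E v))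
    \<le> real (card E) * (2 * real (card E) - real (card V) + 1)"
proof -
  let ?d = "\<lambda>v. real (degree E v)"
  let ?K = "2 * real (card E) - real (card V) + 1"
  \<comment> \<open>The sum has one term, the degree of the other end; this form fits
    \<open>sum_neighbours\<close>.\<close>
  have prod_edge: "prod ?d e = ?d v * sum ?d (e - {v})" if e: "e \<in> E" "v \<in> e" for e v
  proof -
    obtain w where "e - {v} = {w}"
      using card_edge_minus[OF e] card_1_singletonE by metis
    with e finite_edge show ?thesis by (simp add: prod.remove)
  qed
  have "2 * (\<Sum>e\<in>E. prod ?d e) = (\<Sum>e\<in>E. \<Sum>v\<in>e. prod ?d e)"
    using edges by (simp add: sum_distrib_left)
  also have "\<dots> = (\<Sum>v\<in>V. \<Sum>e | e \<in> E \<and> v \<in> e. prod ?d e)"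
    by (rule sum_incident[symmetric])
  also have "\<dots> = (\<Sum>v\<in>V. ?d v * sum ?d (neighbours E v))"
  proof (intro sum.cong refl)
    fix v
    have "(\<Sum>e | e \<in> E \<and> v \<in> e. prod ?d e) = (\<Sum>e | e \<in> E \<and> v \<in> e. ?d v * sum ?d (e - {v}))"
      by (intro sum.cong refl) (simp add: prod_edge)
    then show "(\<Sum>e | e \<in> E \<and> v \<in> e. prod ?d e) = ?d v * sum ?d (neighbours E v)"
      by (simp add: sum_neighbours flip: sum_distrib_left)
  qed
  also have "\<dots> \<le> (\<Sum>v\<in>V. ?d v * ?K)"
    using sum_degree_neighbours_le assms by (intro sum_mono mult_left_mono) auto
  also have "\<dots> = 2 * (real (card E) * ?K)"
    by (simp add: sum_degree flip: sum_distrib_right)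
  finally show ?thesis by simp
qed

end

theorem theorem3:
  fixes V :: "'a set" and E :: "'a set set" and n m :: nat and \<alpha> :: real
  assumes "fin_simple_graph V E"
    and "\<forall>v\<in>V. \<not> isolated E v"
    and "n = card V" and "m = card E"
    and "0 < \<alpha>" and "\<alpha> \<le> 1"
  shows "randic_index \<alpha> E \<le> real m * (2 * real m - real n + 1) powr \<alpha>"
proof (cases "E = {}")
  case True
  then show ?thesis by (simp add: randic_index_def assms)
next
  case False
  interpret fin_simple_graph V E by fact
  let ?p = "\<lambda>e. \<Prod>v\<in>e. real (degree E v)"
  define K where "K = 2 * real m - real n + 1"
  \<comment> \<open>The tangent at \<open>K\<close> needs \<open>0 < K\<close>. It follows from
    squeezing this positive sum below \<open>real m * K\<close>.\<close>
  have "0 < sum ?p E"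
  proof (intro sum_pos finite_E False prod_pos)
    fix e v assume "e \<in> E" "v \<in> e"
    with edges assms(2) degree_ge_1 show "0 < real (degree E v)" by force
  qed
  moreover have R1: "sum ?p E \<le> real m * K"
    using sum_degree_product_le assms by (simp add: K_def)
  ultimately have "0 < real m * K" by linarith
  then have K: "0 < K"
    by (simp add: zero_less_mult_iff)
  have "randic_index \<alpha> E \<le> (\<Sum>e\<in>E. K powr \<alpha> * (1 + \<alpha> * (?p e / K - 1)))"
    unfolding randic_index_def
    by (intro sum_mono powr_le_tangent prod_nonneg K assms) simp
  also have "\<dots> = K powr \<alpha> * (real m + \<alpha> * (sum ?p E / K - real m))"
    by (simp add: assms(4) sum.distrib sum_subtractf flip: sum_distrib_left sum_divide_distrib)
  \<comment> \<open>By \<open>R1\<close> the mean of \<open>?p e / K\<close> is at most 1, so the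
    term with factor \<alpha> is not positive.\<close>
  also have "\<dots> \<le> K powr \<alpha> * real m"
  proof -
    have "sum ?p E / K \<le> real m"
      using R1 K by (simp add: pos_divide_le_eq)
    then show ?thesis
      using assms(5) by (intro mult_left_mono) (auto simp: mult_le_0_iff)
  qed
  finally show ?thesis by (simp add: K_def mult.commute)
qed

end
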